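(* Let $\mathcal{G}$ be a noncompact metric graph with non-empty compact core $\mathcal{K}$, let $m,c>0$, and let $\mathcal{D}$ be the Dirac operator with Kirchhoff-type vertex conditions on $\mathcal{G}$. If $\mathcal{K}$ has a simple cycle, then $\lambda=-mc^2$ is an eigenvalue of the operator $\mathcal{D}$.
   Context: Metric graph. $\mathcal{G}=(\mathrm{V},\mathrm{E})$ is a connected noncompact metric graph with finitely many edges. Each bounded edge $e$ is identified with an interval $I_e=[0,\ell_e]$, $\ell_e>0$; each unbounded edge (half-line) is identified with $I_e=[0,+\infty)$. The compact core $\mathcal{K}$ is the metric subgraph consisting of all bounded edges; it is assumed non-empty. A spinor $u:\mathcal{G}\to\mathbb{C}^2$ is a family $(u_e)_{e\in\mathrm{E}}$ with $u_e=(u_e^1,u_e^2)^T:I_e\to\mathbb{C}^2$; $L^2(\mathcal{G},\mathbb{C}^2)=\bigoplus_{e}L^2(I_e,\mathbb{C}^2)$ and $H^1(\mathcal{G},\mathbb{C}^2)=\bigoplus_{e}H^1(I_e,\mathbb{C}^2)$ (no vertex condition is included in $H^1$). $e\succ \mathrm{v}$ means that $e$ is incident at the vertex $\mathrm{v}$. Dirac operator. For $m,c>0$, $\mathcal{D}$ acts on each edge by $\mathcal{D}_e u_e=-\imath c\,\sigma_1u_e'+mc^2\sigma_3u_e$, with $\sigma_1=\begin{pmatrix}0&1\\1&0\end{pmatrix}$, $\sigma_3=\begin{pmatrix}1&0\\0&-1\end{pmatrix}$, and $\operatorname{dom}(\mathcal{D})$ is the set of $u\in H^1(\mathcal{G},\mathbb{C}^2)$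 such that at every vertex $\mathrm{v}$: $u_e^1(\mathrm{v})=u_f^1(\mathrm{v})$ for all $e,f\succ\mathrm{v}$, and $\sum_{e\succ\mathrm{v}}u_e^2(\mathrm{v})_\pm=0$, where $u_e^2(\mathrm{v})_\pm$ stands for $u_e^2(0)$ or $-u_e^2(\ell_e)$ according to whether the coordinate $x_e$ equals $0$ or $\ell_e$ at $\mathrm{v}$. Simple cycle. $\mathcal{K}$ is regarded as an unordered combinatorial graph, i.e. a set of vertices with a set of edges that are unordered pairs of vertices. A path is a finite sequence of vertices $\{v_k\}_{k=0}^n$ with consecutive vertices adjacent; a closed path is one with $v_0=v_n$; a closed path is a simple cycle if it does not pass through the same edge or vertex more than once (apart from $v_0=v_n$). *)

theory Defs
  imports "HOL-Analysis.Analysis"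
begin

section \<open>Metric graphs\<close>

text \<open>
  Edges are labels of an arbitrary type, so parallel edges and self-loops are allowed.  The
  bounded edge \<open>e\<close> is the interval \<open>[0, len e]\<close>, with \<open>x = 0\<close> at the vertex \<open>org e\<close> and
  \<open>x = len e\<close> at the vertex \<open>dst e\<close>.  A half-line \<open>e\<close> is \<open>[0, \<infinity>)\<close> with \<open>x = 0\<close> at \<open>org e\<close>;
  its values of \<open>len\<close> and \<open>dst\<close> are never used.
\<close>

record ('v, 'e) metric_graph =
  verts :: "'v set"
  bounded_edges :: "'e set"
  half_lines :: "'e set"
  len :: "'e \<Rightarrow> real"
  org :: "'e \<Rightarrow> 'v"
  dst :: "'e \<Rightarrow> 'v"

definition edges :: "('v, 'e) metric_graph \<Rightarrow> 'e set" where
  "edges G = bounded_edges G \<union> half_lines G"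

definition edge_ivl :: "('v, 'e) metric_graph \<Rightarrow> 'e \<Rightarrow> real set" where
  "edge_ivl G e = (if e \<in> bounded_edges G then {0..len G e} else {0..})"

definition adjacent :: "('v, 'e) metric_graph \<Rightarrow> 'v \<Rightarrow> 'v \<Rightarrow> bool" where
  "adjacent G v w \<longleftrightarrow> (\<exists>e\<in>bounded_edges G. {org G e, dst G e} = {v, w})"

text \<open>
  Every half-line is attached to a vertex, so the metric space is connected iff any two
  vertices are joined by a chain of bounded edges.
\<close>

definition connected_metric_graph :: "('v, 'e) metric_graph \<Rightarrow> bool" where
  "connected_metric_graph G \<longleftrightarrow>
     finite (edges G) \<and>
     bounded_edges G \<inter> half_lines G = {} \<and>
     (\<forall>e\<in>edges G. org G e \<in> verts G) \<and>
     (\<forall>e\<in>bounded_edges G. dst G e \<in> verts G \<and> 0 < len G e) \<and>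
     (\<forall>v\<in>verts G. \<forall>w\<in>verts G. (adjacent G)\<^sup>*\<^sup>* v w)"

text \<open>With finitely many edges, all bounded ones being compact, this is noncompactness:\<close>

definition noncompact_metric_graph :: "('v, 'e) metric_graph \<Rightarrow> bool" where
  "noncompact_metric_graph G \<longleftrightarrow> half_lines G \<noteq> {}"


section \<open>Simple cycles in the compact core\<close>

definition core_verts :: "('v, 'e) metric_graph \<Rightarrow> 'v set" where
  "core_verts G = (\<Union>e\<in>bounded_edges G. {org G e, dst G e})"

definition core_path :: "('v, 'e) metric_graph \<Rightarrow> 'v list \<Rightarrow> bool" where
  "core_path G vs \<longleftrightarrow>
     vs \<noteq> [] \<and> set vs \<subseteq> core_verts G \<and>
     (\<forall>k. Suc k < length vs \<longrightarrow> adjacent G (vs ! k) (vs ! Suc k))"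

definition closed_core_path :: "('v, 'e) metric_graph \<Rightarrow> 'v list \<Rightarrow> bool" where
  "closed_core_path G vs \<longleftrightarrow> core_path G vs \<and> 2 \<le> length vs \<and> hd vs = last vs"

text \<open>
  \<open>es\<close> lists the edges passed through by \<open>vs\<close>.  It is determined by \<open>vs\<close> unless there are
  parallel edges: then the two-edge cycle on a pair of parallel edges is a simple cycle, whereas
  going back and forth along one edge is not.  A self-loop is a simple cycle with one edge.
\<close>

definition traverses :: "('v, 'e) metric_graph \<Rightarrow> 'e list \<Rightarrow> 'v list \<Rightarrow> bool" where
  "traverses G es vs \<longleftrightarrow>
     length vs = Suc (length es) \<and> set es \<subseteq> bounded_edges G \<and>
     (\<forall>k<length es. {org G (es ! k), dst G (es ! k)} = {vs ! k, vs ! Suc k})"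

definition simple_cycle :: "('v, 'e) metric_graph \<Rightarrow> 'v list \<Rightarrow> bool" where
  "simple_cycle G vs \<longleftrightarrow>
     closed_core_path G vs \<and> distinct (tl vs) \<and> (\<exists>es. traverses G es vs \<and> distinct es)"


section \<open>The spaces $L^2$ and $H^1$ on an interval\<close>

definition L2_on :: "real set \<Rightarrow> (real \<Rightarrow> 'a::euclidean_space) \<Rightarrow> bool" where
  "L2_on I f \<longleftrightarrow>
     f \<in> borel_measurable (lebesgue_on I) \<and> integrable (lebesgue_on I) (\<lambda>x. (norm (f x))\<^sup>2)"

definition test_function :: "real set \<Rightarrow> (real \<Rightarrow> real) \<Rightarrow> bool" where
  "test_function I \<phi> \<longleftrightarrow>
     (\<forall>n x. (deriv ^^ n) \<phi> field_differentiable at x) \<and>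
     compact (closure {x. \<phi> x \<noteq> 0}) \<and> closure {x. \<phi> x \<noteq> 0} \<subseteq> interior I"

definition has_weak_deriv ::
  "real set \<Rightarrow> (real \<Rightarrow> 'a::euclidean_space) \<Rightarrow> (real \<Rightarrow> 'a) \<Rightarrow> bool" where
  "has_weak_deriv I f g \<longleftrightarrow>
     (\<forall>\<phi>. test_function I \<phi> \<longrightarrow>
        (LINT x|lebesgue_on I. deriv \<phi> x *\<^sub>R f x) = - (LINT x|lebesgue_on I. \<phi> x *\<^sub>R g x))"

text \<open>
  An element of $H^1(I)$ is represented by its continuous representative, so that its values
  at the endpoints of \<open>I\<close> are meaningful.
\<close>

definition H1_on :: "real set \<Rightarrow> (real \<Rightarrow> 'a::euclidean_space) \<Rightarrow> bool" where
  "H1_on I f \<longleftrightarrow>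
     continuous_on I f \<and> L2_on I f \<and> (\<exists>g. L2_on I g \<and> has_weak_deriv I f g)"


section \<open>The Dirac operator with Kirchhoff-type vertex conditions\<close>

type_synonym 'e spinor = "'e \<Rightarrow> real \<Rightarrow> complex ^ 2"

definition sigma1 :: "complex ^ 2 ^ 2" where
  "sigma1 = vector [vector [0, 1], vector [1, 0]]"

definition sigma3 :: "complex ^ 2 ^ 2" where
  "sigma3 = vector [vector [1, 0], vector [0, -1]]"

text \<open>
  The edge ends at \<open>v\<close>, as pairs of an edge and the coordinate of \<open>v\<close> on it.  A self-loop
  contributes both of its ends.
\<close>

definition ends_at :: "('v, 'e) metric_graph \<Rightarrow> 'v \<Rightarrow> ('e \<times> real) set" where
  "ends_at G v =
     {(e, 0) | e. e \<in> edges G \<and> org G e = v} \<union>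
     {(e, len G e) | e. e \<in> bounded_edges G \<and> dst G e = v}"

definition signed_snd :: "'e spinor \<Rightarrow> 'e \<Rightarrow> real \<Rightarrow> complex" where
  "signed_snd u e x = (if x = 0 then u e x $ 2 else - (u e x $ 2))"

definition dirac_dom :: "('v, 'e) metric_graph \<Rightarrow> 'e spinor set" where
  "dirac_dom G =
     {u. (\<forall>e\<in>edges G. H1_on (edge_ivl G e) (u e)) \<and>
         (\<forall>v\<in>verts G.
            (\<forall>(e, x)\<in>ends_at G v. \<forall>(f, y)\<in>ends_at G v. u e x $ 1 = u f y $ 1) \<and>
            (\<Sum>(e, x)\<in>ends_at G v. signed_snd u e x) = 0)}"

text \<open>
  The operator is given by its graph: \<open>dirac_op m c G u w\<close> means that \<open>u\<close> lies in the domain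
  and is mapped to \<open>w\<close>, where equality in $L^2$ is equality almost everywhere on every edge.
\<close>

definition dirac_op ::
  "real \<Rightarrow> real \<Rightarrow> ('v, 'e) metric_graph \<Rightarrow> 'e spinor \<Rightarrow> 'e spinor \<Rightarrow> bool" where
  "dirac_op m c G u w \<longleftrightarrow>
     u \<in> dirac_dom G \<and>
     (\<forall>e\<in>edges G. \<exists>u'. L2_on (edge_ivl G e) u' \<and> has_weak_deriv (edge_ivl G e) (u e) u' \<and>
        (AE x in lebesgue_on (edge_ivl G e).
           w e x = (- \<i> * complex_of_real c) *s (sigma1 *v u' x)
                   + complex_of_real (m * c\<^sup>2) *s (sigma3 *v u e x)))"

definition dirac_eigenvalue ::
  "real \<Rightarrow> real \<Rightarrow> ('v, 'e) metric_graph \<Rightarrow> complex \<Rightarrow> bool" where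
  "dirac_eigenvalue m c G z \<longleftrightarrow>
     (\<exists>u\<in>dirac_dom G.
        \<not> (\<forall>e\<in>edges G. AE x in lebesgue_on (edge_ivl G e). u e x = 0) \<and>
        dirac_op m c G u (\<lambda>e x. z *s u e x))"

end

theory Submission imports Defs begin

text \<open>
  A spinor whose first component vanishes and whose second component is a constant \<open>s e\<close> on
  each edge has derivative zero, so the Dirac operator acts on it only through its mass term
  \<open>m c\<^sup>2 \<sigma>\<^sub>3\<close>, that is, as multiplication by \<open>- m c\<^sup>2\<close>.  Such a spinor is square integrable iff
  \<open>s\<close> vanishes on the half-lines, and for it the vertex conditions say that the values
  \<open>s e\<close>, read as a current from \<open>org e\<close> to \<open>dst e\<close>, obey Kirchhoff's current law: \<open>s\<close> is a
  circulation.  Hence every nonzero circulation on the compact core yields an eigenfunction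
  (\<open>circulation_imp_eigenvalue\<close>).

  A cycle carries the circulation that sends a unit current around it
  (\<open>cycle_flow_conserved\<close>), and as no edge is passed through twice, no two of its
  contributions can cancel (\<open>cycle_flow_first_edge\<close>).
\<close>

section \<open>Constant functions in Sobolev spaces\<close>

lemma L2_on_const:
  assumes "I \<in> lmeasurable"
  shows "L2_on I (\<lambda>x. k)"
proof -
  have "finite_measure (lebesgue_on I)"
    using assms by (rule finite_measure_lebesgue_on)
  then have "integrable (lebesgue_on I) (\<lambda>x. (norm k)\<^sup>2)"
    by (rule finite_measure.integrable_const)
  then show ?thesis by (simp add: L2_on_def)
qed

lemma L2_on_zero: "L2_on I (\<lambda>x. 0)"
  by (simp add: L2_on_def)

lemma has_weak_deriv_zero: "has_weak_deriv I (\<lambda>x. 0) (\<lambda>x. 0)"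
  by (simp add: has_weak_deriv_def)

text \<open>
  The support of a test function lies in the open interval, so the test function vanishes at
  both endpoints and the fundamental theorem of calculus gives the value \<open>0\<close>.
\<close>

lemma has_bochner_integral_deriv_test_function:
  fixes a b :: real
  assumes "a \<le> b" and "test_function {a..b} \<phi>"
  shows "has_bochner_integral (lebesgue_on {a..b}) (deriv \<phi>) 0"
proof -
  have diff: "(deriv ^^ n) \<phi> field_differentiable at x" for n x
    using assms(2) by (simp add: test_function_def)
  have deriv: "(\<phi> has_real_derivative deriv \<phi> x) (at x)" for x
    using diff[of 0 x] by (simp add: field_differentiable_derivI)
  have "continuous_on UNIV (deriv \<phi>)"
    using diff[of 1]
    by (auto simp: continuous_on_eq_continuous_at intro: field_differentiable_imp_continuous_at)
  then have "continuous_on {a..b} (deriv \<phi>)"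
    by (rule continuous_on_subset) simp
  then have int: "integrable (lebesgue_on {a..b}) (deriv \<phi>)"
    by (intro continuous_imp_integrable_real)
  from int have "(LINT x|lebesgue_on {a..b}. deriv \<phi> x) = integral {a..b} (deriv \<phi>)"
    by (intro lebesgue_integral_eq_integral) auto
  also have "\<dots> = \<phi> b - \<phi> a"
    using \<open>a \<le> b\<close> deriv
    by (intro integral_unique fundamental_theorem_of_calculus)
      (auto simp: has_real_derivative_iff_has_vector_derivative[symmetric]
            intro: has_field_derivative_at_within)
  also have "\<dots> = 0"
  proof -
    have "{x. \<phi> x \<noteq> 0} \<subseteq> {a<..<b}"
      using assms(2) closure_subset[of "{x. \<phi> x \<noteq> 0}"]
      unfolding test_function_def by (auto simp: interior_atLeastAtMost_real)
    then have "\<phi> a = 0" "\<phi> b = 0" by auto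
    then show ?thesis by simp
  qed
  finally show ?thesis
    using int by (simp add: has_bochner_integral_iff)
qed

lemma has_weak_deriv_const:
  fixes a b :: real and k :: "'a::euclidean_space"
  assumes "a \<le> b"
  shows "has_weak_deriv {a..b} (\<lambda>x. k) (\<lambda>x. 0)"
proof -
  have "(LINT x|lebesgue_on {a..b}. deriv \<phi> x *\<^sub>R k) = 0" if "test_function {a..b} \<phi>" for \<phi>
    using has_bochner_integral_scaleR_left[OF has_bochner_integral_deriv_test_function[OF assms that], of k]
    by (simp add: has_bochner_integral_iff)
  then show ?thesis by (simp add: has_weak_deriv_def)
qed

lemma AE_interval_imp_ex:
  fixes a b :: real
  assumes "a < b" and "AE x in lebesgue_on {a..b}. P x"
  shows "\<exists>x. P x"
proof (rule ccontr)
  assume "\<nexists>x. P x"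
  then have "AE x in lebesgue_on {a..b}. \<not> True"
    using assms(2) by simp
  then have "emeasure (lebesgue_on {a..b}) {x \<in> space (lebesgue_on {a..b}). True} = 0"
    by (rule emeasure_eq_0_AE)
  moreover have "emeasure (lebesgue_on {a..b}) {x \<in> space (lebesgue_on {a..b}). True} = ennreal (b - a)"
    using assms(1) by (simp add: emeasure_restrict_space flip: atLeastAtMost_iff)
  ultimately show False using assms(1) by simp
qed


section \<open>Eigenfunctions from circulations\<close>

definition circulation :: "('v, 'e) metric_graph \<Rightarrow> ('e \<Rightarrow> complex) \<Rightarrow> bool" where
  "circulation G s \<longleftrightarrow>
     (\<forall>e. e \<notin> bounded_edges G \<longrightarrow> s e = 0) \<and>
     (\<forall>v\<in>verts G. (\<Sum>e\<in>bounded_edges G. s e * (of_bool (org G e = v) - of_bool (dst G e = v))) = 0)"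

definition current_spinor :: "('e \<Rightarrow> complex) \<Rightarrow> 'e spinor" where
  "current_spinor s e x = vector [0, s e]"

lemma current_spinor_nth [simp]:
  "current_spinor s e x $ 1 = 0" "current_spinor s e x $ 2 = s e"
  by (simp_all add: current_spinor_def)

text \<open>
  Since bounded edges have positive length, their two ends are distinct pairs, also on a
  self-loop, and the sum over ends splits into outgoing and incoming currents.
\<close>

lemma sum_ends_current_spinor:
  assumes G: "connected_metric_graph G" and supp: "\<And>e. e \<notin> bounded_edges G \<Longrightarrow> s e = 0"
  shows "(\<Sum>(e, x)\<in>ends_at G v. signed_snd (current_spinor s) e x) =
    (\<Sum>e\<in>bounded_edges G. s e * (of_bool (org G e = v) - of_bool (dst G e = v)))"
proof -
  let ?E = "edges G" and ?B = "bounded_edges G"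
  let ?g = "\<lambda>(e, x). signed_snd (current_spinor s) e x"
  have finE: "finite ?E" and len: "\<And>e. e \<in> ?B \<Longrightarrow> 0 < len G e"
    using G by (auto simp: connected_metric_graph_def)
  have BE: "?B \<subseteq> ?E" by (auto simp: edges_def)
  with finE have finB: "finite ?B" by (rule finite_subset[rotated])
  let ?O = "{e\<in>?E. org G e = v}" and ?D = "{e\<in>?B. dst G e = v}"
  have ends: "ends_at G v = (\<lambda>e. (e, 0)) ` ?O \<union> (\<lambda>e. (e, len G e)) ` ?D"
    by (auto simp: ends_at_def)
  have "sum ?g (ends_at G v) = sum ?g ((\<lambda>e. (e, 0)) ` ?O) + sum ?g ((\<lambda>e. (e, len G e)) ` ?D)"
    unfolding ends using finE finB len by (intro sum.union_disjoint) force+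
  also have "sum ?g ((\<lambda>e. (e, 0)) ` ?O) = (\<Sum>e\<in>?O. s e)"
    by (subst sum.reindex) (auto simp: inj_on_def signed_snd_def)
  also have "\<dots> = (\<Sum>e\<in>?E. s e * of_bool (org G e = v))"
    using finE by (simp add: sum.inter_filter of_bool_def if_distrib cong: if_cong)
  also have "\<dots> = (\<Sum>e\<in>?B. s e * of_bool (org G e = v))"
    using finE BE supp by (intro sum.mono_neutral_right) auto
  also have "sum ?g ((\<lambda>e. (e, len G e)) ` ?D) = (\<Sum>e\<in>?D. - s e)"
    using len by (subst sum.reindex) (force simp: inj_on_def signed_snd_def intro!: sum.cong)+
  also have "\<dots> = (\<Sum>e\<in>?B. - (s e * of_bool (dst G e = v)))"
    using finB by (simp add: sum.inter_filter of_bool_def if_distrib cong: if_cong)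
  finally show ?thesis
    by (simp add: sum.distrib[symmetric] algebra_simps)
qed

lemma current_spinor_edge:
  assumes G: "connected_metric_graph G" and supp: "\<And>e. e \<notin> bounded_edges G \<Longrightarrow> s e = 0"
  shows "H1_on (edge_ivl G e) (current_spinor s e)"
    and "has_weak_deriv (edge_ivl G e) (current_spinor s e) (\<lambda>x. 0)"
proof -
  have const: "current_spinor s e = (\<lambda>x. vector [0, s e])"
    by (simp add: current_spinor_def fun_eq_iff)
  have "L2_on (edge_ivl G e) (current_spinor s e) \<and>
        has_weak_deriv (edge_ivl G e) (current_spinor s e) (\<lambda>x. 0)"
  proof (cases "e \<in> bounded_edges G")
    case True
    then have "0 < len G e" using G by (auto simp: connected_metric_graph_def)
    then show ?thesis
      using True unfolding const by (simp add: edge_ivl_def L2_on_const has_weak_deriv_const)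
  next
    case False
    then have "current_spinor s e = (\<lambda>x. 0)"
      using supp by (simp add: fun_eq_iff vec_eq_iff forall_2)
    then show ?thesis by (simp add: L2_on_zero has_weak_deriv_zero)
  qed
  moreover have "continuous_on (edge_ivl G e) (current_spinor s e)"
    unfolding const by simp
  ultimately show "H1_on (edge_ivl G e) (current_spinor s e)"
    and "has_weak_deriv (edge_ivl G e) (current_spinor s e) (\<lambda>x. 0)"
    using L2_on_zero by (auto simp: H1_on_def)
qed

lemma circulation_imp_eigenvalue:
  assumes G: "connected_metric_graph G" and s: "circulation G s" and nz: "s e0 \<noteq> 0"
  shows "dirac_eigenvalue m c G (- complex_of_real (m * c\<^sup>2))"
proof -
  let ?u = "current_spinor s"
  have supp: "\<And>e. e \<notin> bounded_edges G \<Longrightarrow> s e = 0"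
    using s by (simp add: circulation_def)
  have dom: "?u \<in> dirac_dom G"
    using s current_spinor_edge(1)[where s = s, OF G supp]
      sum_ends_current_spinor[where s = s, OF G supp]
    by (simp add: dirac_dom_def circulation_def case_prod_beta)
  have e0: "e0 \<in> bounded_edges G" using nz supp by blast
  then have "0 < len G e0" using G by (auto simp: connected_metric_graph_def)
  moreover have "?u e0 x \<noteq> 0" for x
    using nz by (metis current_spinor_nth(2) zero_index)
  moreover have "edge_ivl G e0 = {0..len G e0}" using e0 by (simp add: edge_ivl_def)
  ultimately have "\<not> (AE x in lebesgue_on (edge_ivl G e0). ?u e0 x = 0)"
    using AE_interval_imp_ex[of 0 "len G e0" "\<lambda>x. ?u e0 x = 0"] by metis
  then have nontrivial: "\<not> (\<forall>e\<in>edges G. AE x in lebesgue_on (edge_ivl G e). ?u e x = 0)"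
    using e0 by (auto simp: edges_def)
  have mass: "- complex_of_real (m * c\<^sup>2) *s ?u e x =
      (- \<i> * complex_of_real c) *s (sigma1 *v 0) + complex_of_real (m * c\<^sup>2) *s (sigma3 *v ?u e x)"
    for e x
    by (simp add: vec_eq_iff forall_2 sigma3_def matrix_vector_mult_def sum_2)
  have "dirac_op m c G ?u (\<lambda>e x. - complex_of_real (m * c\<^sup>2) *s ?u e x)"
    unfolding dirac_op_def
  proof (intro conjI ballI exI)
    fix e
    show "has_weak_deriv (edge_ivl G e) (?u e) (\<lambda>x. 0)"
      using current_spinor_edge(2)[where s = s, OF G supp] .
  qed (use dom mass L2_on_zero in auto)
  then show ?thesis
    unfolding dirac_eigenvalue_def using dom nontrivial by blast
qed


section \<open>The unit current around a cycle\<close>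

text \<open>
  The sign records whether the step from \<open>vs ! k\<close> follows the edge in the direction of its
  coordinate; a self-loop always counts as followed in that direction.
\<close>

definition cycle_flow ::
  "('v, 'e) metric_graph \<Rightarrow> 'e list \<Rightarrow> 'v list \<Rightarrow> 'e \<Rightarrow> complex" where
  "cycle_flow G es vs e =
     (\<Sum>k<length es. of_bool (es ! k = e) * (if org G e = vs ! k then 1 else - 1))"

lemma cycle_flow_off_core:
  assumes "traverses G es vs" and "e \<notin> bounded_edges G"
  shows "cycle_flow G es vs e = 0"
  using assms unfolding cycle_flow_def traverses_def
  by (intro sum.neutral) (auto dest: nth_mem)

text \<open>
  The \<open>k\<close>-th step contributes \<open>+1\<close> at \<open>vs ! k\<close> and \<open>-1\<close> at \<open>vs ! Suc k\<close>, in either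
  direction of the edge, so the net current out of \<open>v\<close> telescopes along the path.
\<close>

lemma cycle_flow_conserved:
  assumes fin: "finite (bounded_edges G)" and tr: "traverses G es vs" and closed: "hd vs = last vs"
  shows "(\<Sum>e\<in>bounded_edges G.
    cycle_flow G es vs e * (of_bool (org G e = v) - of_bool (dst G e = v))) = 0"
proof -
  let ?n = "length es" and ?B = "bounded_edges G"
  let ?f = "\<lambda>e. of_bool (org G e = v) - of_bool (dst G e = v) :: complex"
  let ?t = "\<lambda>k e. if org G e = vs ! k then 1 else - 1 :: complex"
  let ?p = "\<lambda>k. of_bool (vs ! k = v) :: complex"
  have lenvs: "length vs = Suc ?n" and mem: "\<And>k. k < ?n \<Longrightarrow> es ! k \<in> ?B"
    and ends: "\<And>k. k < ?n \<Longrightarrow> {org G (es ! k), dst G (es ! k)} = {vs ! k, vs ! Suc k}"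
    using tr by (auto simp: traverses_def)
  have "(\<Sum>e\<in>?B. cycle_flow G es vs e * ?f e) =
      (\<Sum>k<?n. \<Sum>e\<in>?B. of_bool (es ! k = e) * ?t k e * ?f e)"
    unfolding cycle_flow_def sum_distrib_right by (rule sum.swap)
  also have "\<dots> = (\<Sum>k<?n. ?t k (es ! k) * ?f (es ! k))"
  proof (rule sum.cong)
    fix k assume "k \<in> {..<?n}"
    then have "(\<Sum>e\<in>?B. if es ! k = e then ?t k e * ?f e else 0) = ?t k (es ! k) * ?f (es ! k)"
      using mem fin by (subst sum.delta') auto
    then show "(\<Sum>e\<in>?B. of_bool (es ! k = e) * ?t k e * ?f e) = ?t k (es ! k) * ?f (es ! k)"
      by (smt (verit) mult_cancel_right1 mult_zero_left of_bool_eq sum.cong)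
  qed simp
  also have "\<dots> = (\<Sum>k<?n. ?p k - ?p (Suc k))"
  proof (rule sum.cong)
    fix k assume "k \<in> {..<?n}"
    then have "{org G (es ! k), dst G (es ! k)} = {vs ! k, vs ! Suc k}"
      using ends by simp
    then consider "org G (es ! k) = vs ! k" "dst G (es ! k) = vs ! Suc k"
      | "org G (es ! k) \<noteq> vs ! k" "org G (es ! k) = vs ! Suc k" "dst G (es ! k) = vs ! k"
      by (metis doubleton_eq_iff)
    then show "?t k (es ! k) * ?f (es ! k) = ?p k - ?p (Suc k)"
      by cases simp_all
  qed simp
  also have "\<dots> = ?p 0 - ?p ?n"
    by (rule sum_lessThan_telescope')
  also have "\<dots> = 0"
  proof -
    have "vs \<noteq> []" using lenvs by auto
    then have "vs ! 0 = vs ! ?n"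
      using closed lenvs by (simp add: hd_conv_nth last_conv_nth)
    then show ?thesis by simp
  qed
  finally show ?thesis .
qed

lemma cycle_flow_first_edge:
  assumes "distinct es" and "es \<noteq> []"
  shows "cycle_flow G es vs (es ! 0) \<noteq> 0"
proof -
  have "cycle_flow G es vs (es ! 0) =
      (\<Sum>k<length es. if k = 0 then (if org G (es ! 0) = vs ! 0 then 1 else - 1) else 0)"
    unfolding cycle_flow_def using assms
    by (intro sum.cong) (auto simp: nth_eq_iff_index_eq)
  also have "\<dots> \<noteq> 0"
    using assms(2) by (subst sum.delta) auto
  finally show ?thesis .
qed

theorem mainTheorem10:
  fixes G :: "('v, 'e) metric_graph" and m c :: real
  assumes "connected_metric_graph G"
    and "noncompact_metric_graph G"
    and "bounded_edges G \<noteq> {}"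
    and "m > 0" and "c > 0"
    and "\<exists>vs. simple_cycle G vs"
  shows "dirac_eigenvalue m c G (- complex_of_real (m * c\<^sup>2))"
proof -
  obtain vs es where closed: "hd vs = last vs" and long: "2 \<le> length vs"
    and tr: "traverses G es vs" and dist: "distinct es"
    using assms(6) by (auto simp: simple_cycle_def closed_core_path_def)
  have "finite (bounded_edges G)"
    using assms(1) by (simp add: connected_metric_graph_def edges_def)
  then have "circulation G (cycle_flow G es vs)"
    using cycle_flow_off_core[OF tr] cycle_flow_conserved[OF _ tr closed]
    by (simp add: circulation_def)
  moreover have "es \<noteq> []"
    using long tr by (auto simp: traverses_def)
  then have "cycle_flow G es vs (es ! 0) \<noteq> 0"
    using dist by (intro cycle_flow_first_edge)
  ultimately show ?thesis
    using circulation_imp_eigenvalue[OF assms(1)] by blast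
qed

end
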